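(* Let $n\ge 1$ and $p>1$. There exists a sequence of centered probability measures $d\mu_k=f_k\,d\gamma$ in $\mathcal{P}_2(\mathbb{R}^n)$ such that $\lim_{k\to\infty}\delta_{\mathrm{Tal}}(\mu_k)=0$ and $\lim_{k\to\infty}W_p(\mu_k,\gamma)=\infty$.
   Context: $d\gamma=(2\pi)^{-n/2}e^{-|x|^2/2}\,dx$ is the standard Gaussian measure on $\mathbb{R}^n$. For a probability measure $d\mu=f\,d\gamma$ with $f\ge 0$ in $L^1(d\gamma)$, the relative entropy is $\mathrm{H}(\mu)=\int_{\mathbb{R}^n}f\log f\,d\gamma$. For $p\ge1$, $\mathcal{P}_p(\mathbb{R}^n)$ is the set of probability measures $\mu$ on $\mathbb{R}^n$ with finite $p$-th moment $m_p(\mu)=\int|x|^p\,d\mu$. For $\mu,\nu\in\mathcal{P}_p(\mathbb{R}^n)$, the Wasserstein distance of order $p$ is $W_p(\mu,\nu)=\inf_\pi\left(\iint|x-y|^p\,d\pi(x,y)\right)^{1/p}$, the infimum being over all probability measures $\pi$ on $\mathbb{R}^n\times\mathbb{R}^n$ with marginals $\mu$ and $\nu$. The deficit of Talagrand's transportation inequality is $\delta_{\mathrm{Tal}}(\mu)=2\mathrm{H}(\mu)-W_2^2(\mu,\gamma)\ge 0$. Centered means the barycenter $\int x\,d\mu$ is $0$. *)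

theory Defs
  imports "HOL-Probability.Probability"
begin

definition gaussian :: "'a::euclidean_space measure" where
  "gaussian = density lborel
     (\<lambda>x. ennreal ((2 * pi) powr (- (real DIM('a) / 2)) * exp (- ((norm x)\<^sup>2 / 2))))"

definition wasserstein_space :: "real \<Rightarrow> 'a::euclidean_space measure set" where
  "wasserstein_space p =
     {\<mu>. prob_space \<mu> \<and> sets \<mu> = sets borel \<and> integrable \<mu> (\<lambda>x. norm x powr p)}"

definition couplings ::
  "'a::euclidean_space measure \<Rightarrow> 'a measure \<Rightarrow> ('a \<times> 'a) measure set" where
  "couplings \<mu> \<nu> =
     {\<pi>. prob_space \<pi> \<and> sets \<pi> = sets borel \<and>
         distr \<pi> borel fst = \<mu> \<and> distr \<pi> borel snd = \<nu>}"

text \<open>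
  The following is only meaningful when both measures belong to
  \<^term>\<open>wasserstein_space p\<close> with \<open>p \<ge> 1\<close>: then the cost is integrable for every
  coupling, the set of couplings contains the product measure, and the infimum is a finite
  nonnegative real.
\<close>

definition wasserstein ::
  "real \<Rightarrow> 'a::euclidean_space measure \<Rightarrow> 'a measure \<Rightarrow> real" where
  "wasserstein p \<mu> \<nu> =
     (INF \<pi>\<in>couplings \<mu> \<nu>. (LINT z|\<pi>. norm (fst z - snd z) powr p) powr (1 / p))"

text \<open>
  Entropy relative to the Gaussian measure, for measures that are absolutely continuous with
  respect to it. As \<open>f log f \<ge> - 1 / e\<close>, the integral always exists in \<open>(-\<infinity>, \<infinity>]\<close>, and it
  is \<open>\<infinity>\<close> exactly when \<open>f log f\<close> is not integrable. The library's \<open>0 * ln 0 = 0\<close> is the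
  usual convention.
\<close>

definition rel_entropy :: "'a::euclidean_space measure \<Rightarrow> ereal" where
  "rel_entropy \<mu> =
     (let f = (\<lambda>x. enn2real (RN_deriv gaussian \<mu> x)) in
      if integrable gaussian (\<lambda>x. f x * ln (f x))
      then ereal (LINT x|gaussian. f x * ln (f x)) else \<infinity>)"

definition talagrand_deficit :: "'a::euclidean_space measure \<Rightarrow> ereal" where
  "talagrand_deficit \<mu> = 2 * rel_entropy \<mu> - ereal ((wasserstein 2 \<mu> gaussian)\<^sup>2)"

definition centered :: "'a::euclidean_space measure \<Rightarrow> bool" where
  "centered \<mu> \<longleftrightarrow> integrable \<mu> (\<lambda>x. x) \<and> (LINT x|\<mu>. x) = 0"

end

theory Submission
  imports Defs "HOL-Real_Asymp.Real_Asymp"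
begin

text \<open>
  The measures are Gaussian mixtures $\mu = (1 - \epsilon)\gamma +
  \frac{\epsilon}{2}(\gamma_v + \gamma_{-v})$, where $\gamma_v$ is $\gamma$ translated by $v$.
  Both $2H(\mu)$ and $W_2^2(\mu, \gamma)$ equal $\epsilon |v|^2$ up to a small error. Convexity of
  $s \log s$ and the trivial coupling give the upper bounds. Bounding the density of $\mu$ below by
  each single component gives $2H(\mu) \ge \epsilon |v|^2 - o(1)$ as $\epsilon \to 0$.
  The bound $W_2^2(\mu, \gamma) \ge \epsilon |v|^2 - o(1)$ holds provided that
  $\epsilon |v|^{1 + \kappa} \to 0$ for some $\kappa > 0$, whereas $W_p(\mu, \gamma) \to \infty$
  as soon as $\epsilon |v|^p \to \infty$. For $p > 1$ both can be achieved, by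
  $|v| = t^j$ and $\epsilon = t^{-(j + 2)}$ with $t \to \infty$ and $j$ large.
\<close>

section \<open>Moments and translations of the Gaussian measure\<close>

text \<open>The integrand factors over \<open>Basis\<close>. Each one-dimensional factor is a
  multiple of the centered normal density whose variance satisfies
  \<open>2 * \<sigma>\<^sup>2 = 1 / c\<close>. The value \<open>c = 1/2\<close> normalizes the
  Gaussian, and \<open>c = 1/4\<close> gives an exponential moment.\<close>

lemma nn_integral_exp_norm_square:
  fixes c :: real
  assumes "c > 0"
  shows "(\<integral>\<^sup>+(x::'a::euclidean_space). ennreal (exp (- c * (norm x)\<^sup>2)) \<partial>lborel) =
    ennreal (sqrt (pi / c) ^ DIM('a))"
proof -
  have one: "(\<integral>\<^sup>+x. ennreal (exp (- c * x\<^sup>2)) \<partial>lborel) = ennreal (sqrt (pi / c))"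
  proof -
    define \<sigma> where "\<sigma> = sqrt (1 / (2 * c))"
    have \<sigma>: "\<sigma> > 0" "2 * \<sigma>\<^sup>2 = 1 / c" using assms by (simp_all add: \<sigma>_def)
    have "exp (- c * x\<^sup>2) = sqrt (pi / c) * normal_density 0 \<sigma> x" for x
    proof -
      have "2 * pi * \<sigma>\<^sup>2 = pi / c" using \<sigma>(2) by (simp add: field_simps)
      moreover have "sqrt (pi / c) > 0" using assms by simp
      ultimately show ?thesis using assms \<sigma>(2) by (simp add: normal_density_def)
    qed
    then have "(\<integral>\<^sup>+x. ennreal (exp (- c * x\<^sup>2)) \<partial>lborel) =
        (\<integral>\<^sup>+x. ennreal (sqrt (pi / c)) * ennreal (normal_density 0 \<sigma> x) \<partial>lborel)"
      using assms by (simp add: ennreal_mult)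
    also have "\<dots> = ennreal (sqrt (pi / c)) * (\<integral>\<^sup>+x. ennreal (normal_density 0 \<sigma> x) \<partial>lborel)"
      by (rule nn_integral_cmult) simp
    also have "(\<integral>\<^sup>+x. ennreal (normal_density 0 \<sigma> x) \<partial>lborel) = 1"
      using \<sigma>(1) by (subst nn_integral_eq_integral) auto
    finally show ?thesis by simp
  qed
  have "exp (- c * (norm x)\<^sup>2) = (\<Prod>b\<in>Basis. exp (- c * (x \<bullet> b)\<^sup>2))" for x :: 'a
  proof -
    have "(norm x)\<^sup>2 = (\<Sum>b\<in>Basis. (x \<bullet> b)\<^sup>2)"
      by (subst euclidean_inner[of x x, folded power2_norm_eq_inner])
        (simp add: power2_eq_square)
    then show ?thesis by (simp add: sum_distrib_left exp_sum)
  qed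
  then have "(\<integral>\<^sup>+(x::'a). ennreal (exp (- c * (norm x)\<^sup>2)) \<partial>lborel) =
      (\<integral>\<^sup>+(x::'a). (\<Prod>b\<in>Basis. ennreal (exp (- c * (x \<bullet> b)\<^sup>2))) \<partial>lborel)"
    by (simp add: prod_ennreal)
  also have "\<dots> = (\<Prod>b\<in>(Basis::'a set). ennreal (sqrt (pi / c)))"
    by (subst nn_integral_lborel_prod) (simp_all only: one, auto)
  also have "\<dots> = ennreal (sqrt (pi / c) ^ DIM('a))"
    using assms by (simp add: ennreal_power)
  finally show ?thesis .
qed

lemma sets_gaussian [simp, measurable_cong]: "sets gaussian = sets borel"
  by (simp add: gaussian_def)

lemma space_gaussian [simp]: "space gaussian = UNIV"
  by (simp add: gaussian_def)

abbreviation gaussian_density :: "'a::euclidean_space \<Rightarrow> real" where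
  "gaussian_density x \<equiv> (2 * pi) powr (- (real DIM('a) / 2)) * exp (- ((norm x)\<^sup>2 / 2))"

lemma gaussian_measurable [simp]:
  "measurable gaussian M = measurable borel M"
  by (rule measurable_cong_sets) simp_all

lemma prob_space_gaussian: "prob_space (gaussian :: 'a::euclidean_space measure)"
proof
  have "emeasure (gaussian :: 'a measure) (space gaussian) =
      (\<integral>\<^sup>+(x::'a). ennreal ((2 * pi) powr (- (real DIM('a) / 2))) * ennreal (exp (- (1/2) * (norm x)\<^sup>2)) \<partial>lborel)"
    unfolding gaussian_def by (simp add: emeasure_density ennreal_mult)
  also have "\<dots> = ennreal ((2 * pi) powr (- (real DIM('a) / 2))) * ennreal (sqrt (pi / (1/2)) ^ DIM('a))"
    by (subst nn_integral_cmult, measurable, subst nn_integral_exp_norm_square) auto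
  also have "sqrt (pi / (1/2)) ^ DIM('a) = (2 * pi) powr (real DIM('a) / 2)"
    by (simp add: powr_half_sqrt[symmetric] powr_realpow[symmetric] powr_powr mult.commute)
  also have "ennreal ((2 * pi) powr (- (real DIM('a) / 2))) * ennreal ((2 * pi) powr (real DIM('a) / 2)) = 1"
    by (simp add: ennreal_mult[symmetric] powr_add[symmetric])
  finally show "emeasure (gaussian :: 'a measure) (space gaussian) = 1" .
qed

text \<open>Against the Gaussian weight, half of the decay survives: what remains is
  \<open>exp (- (1/4) * (norm x)\<^sup>2)\<close>. This one function dominates all powers of the
  norm.\<close>

lemma integrable_gaussian_exp_norm_square:
  "integrable (gaussian :: 'a::euclidean_space measure) (\<lambda>x. exp ((norm x)\<^sup>2 / 4))"
proof (rule integrableI_nonneg)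
  have "(\<integral>\<^sup>+x. ennreal (exp ((norm x)\<^sup>2 / 4)) \<partial>(gaussian :: 'a measure)) =
      (\<integral>\<^sup>+(x::'a). ennreal ((2 * pi) powr (- (real DIM('a) / 2))) * ennreal (exp (- (1/4) * (norm x)\<^sup>2)) \<partial>lborel)"
    unfolding gaussian_def
    by (subst nn_integral_density, measurable, intro nn_integral_cong)
      (simp add: ennreal_mult[symmetric] mult_exp_exp mult.assoc)
  also have "\<dots> = ennreal ((2 * pi) powr (- (real DIM('a) / 2))) * ennreal (sqrt (pi / (1/4)) ^ DIM('a))"
    by (subst nn_integral_cmult, measurable, subst nn_integral_exp_norm_square) auto
  also have "\<dots> < \<infinity>" by (simp add: ennreal_mult_less_top)
  finally show "(\<integral>\<^sup>+x. ennreal (exp ((norm x)\<^sup>2 / 4)) \<partial>(gaussian :: 'a measure)) < \<infinity>" .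
qed auto

text \<open>With r the norm of x, r^m / m! is a single term of the series of exp r, and r \<le> 1 +
  r^2 / 4 because (r / 2 - 1)^2 is nonnegative.\<close>

lemma integrable_gaussian_norm_power:
  "integrable (gaussian :: 'a::euclidean_space measure) (\<lambda>x. norm x ^ m)"
proof (rule Bochner_Integration.integrable_bound)
  show "integrable (gaussian :: 'a measure) (\<lambda>x. fact m * exp 1 * exp ((norm x)\<^sup>2 / 4))"
    by (intro integrable_mult_right integrable_gaussian_exp_norm_square)
  have "norm x ^ m \<le> fact m * exp 1 * exp ((norm x)\<^sup>2 / 4)" for x :: 'a
  proof -
    have "norm x ^ m / fact m \<le> exp (norm x)"
      using sum_le_suminf[OF summable_exp_generic[of "norm x"], of "{m}"]
      by (simp add: exp_def divide_inverse mult.commute)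
    also have "\<dots> \<le> exp (1 + (norm x)\<^sup>2 / 4)"
      using zero_le_power2[of "norm x / 2 - 1"] by (simp add: power2_eq_square field_simps)
    finally show ?thesis unfolding exp_add by (simp add: field_simps)
  qed
  then show "AE x in (gaussian :: 'a measure). norm (norm x ^ m) \<le> norm (fact m * exp 1 * exp ((norm x)\<^sup>2 / 4))"
    by simp
qed simp

lemma integrable_gaussian_norm [simp]:
  "integrable (gaussian :: 'a::euclidean_space measure) norm"
  using integrable_gaussian_norm_power[of 1] by simp

lemma integrable_gaussian_id [simp]:
  "integrable (gaussian :: 'a::euclidean_space measure) (\<lambda>x. x)"
  by (rule Bochner_Integration.integrable_bound[OF integrable_gaussian_norm]) auto

text \<open>A real exponent is dominated by 1 plus the integer power with exponent
  \<open>nat \<lceil>q\<rceil>\<close>. The shift is built in because integrals against the mixture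
  become Gaussian integrals of translates.\<close>

lemma integrable_gaussian_norm_powr:
  assumes "q \<ge> 0"
  shows "integrable (gaussian :: 'a::euclidean_space measure) (\<lambda>x. norm (x + v) powr q)"
proof (rule Bochner_Integration.integrable_bound)
  interpret prob_space "gaussian :: 'a measure" by (rule prob_space_gaussian)
  define m where "m = nat \<lceil>q\<rceil>"
  show "integrable (gaussian :: 'a measure) (\<lambda>x. 1 + 2 ^ m * (norm x ^ m + norm v ^ m))"
    by (intro Bochner_Integration.integrable_add integrable_mult_right integrable_gaussian_norm_power) simp_all
  have "norm (x + v) powr q \<le> 1 + 2 ^ m * (norm x ^ m + norm v ^ m)" for x :: 'a
  proof -
    have "norm (x + v) powr q \<le> 1 + norm (x + v) ^ m"
    proof (cases "norm (x + v) \<le> 1")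
      case True
      then have "norm (x + v) powr q \<le> 1" using assms by (intro powr_le1) auto
      then show ?thesis by (smt (verit) norm_ge_zero zero_le_power)
    next
      case False
      then have "norm (x + v) powr q \<le> norm (x + v) powr real m"
        by (intro powr_mono) (auto simp: m_def real_nat_ceiling_ge)
      with False show ?thesis by (subst (asm) powr_realpow) linarith+
    qed
    also have "norm (x + v) ^ m \<le> (2 * max (norm x) (norm v)) ^ m"
      by (intro power_mono) (auto intro: norm_triangle_le)
    also have "\<dots> \<le> 2 ^ m * (norm x ^ m + norm v ^ m)"
      by (simp add: power_mult_distrib max_def)
    finally show ?thesis by simp
  qed
  then show "AE x in (gaussian :: 'a measure). norm (norm (x + v) powr q) \<le>
      norm (1 + 2 ^ m * (norm x ^ m + norm v ^ m))"
    by (intro AE_I2) (simp add: order_trans[OF _ abs_ge_self])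
qed simp

section \<open>Exponential tilts as translations of the Gaussian measure\<close>

text \<open>This is the Cameron-Martin density of the Gaussian translated by \<open>v\<close>,
  relative to the untranslated one.\<close>

definition tilt :: "'a::euclidean_space \<Rightarrow> 'a \<Rightarrow> real" where
  "tilt v x = exp (v \<bullet> x - (norm v)\<^sup>2 / 2)"

lemma tilt_measurable [measurable]: "tilt v \<in> borel_measurable borel"
  unfolding tilt_def by measurable

lemma tilt_pos: "0 < tilt v x"
  by (simp add: tilt_def)

text \<open>Completing the square shows that the Gaussian density times the tilt, evaluated at
  \<open>v + x\<close>, is the Gaussian density at \<open>x\<close>. Translation invariance of
  Lebesgue measure does the rest.\<close>

lemma density_tilt:
  "density gaussian (\<lambda>x. ennreal (tilt v x)) = distr gaussian borel (\<lambda>x. x + v)"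
    (is "?L = ?R")
proof (rule measure_eqI)
  fix A assume "A \<in> sets ?L"
  then have A [measurable]: "A \<in> sets borel" by simp
  have *: "gaussian_density (v + x) * tilt v (v + x) = gaussian_density x" for x :: 'a
  proof -
    have "- ((norm (v + x))\<^sup>2 / 2) + (v \<bullet> (v + x) - (norm v)\<^sup>2 / 2) = - ((norm x)\<^sup>2 / 2)"
      by (simp add: power2_norm_eq_inner algebra_simps inner_commute)
    then show ?thesis by (simp add: tilt_def mult.assoc mult_exp_exp)
  qed
  have "emeasure ?L A = (\<integral>\<^sup>+x. ennreal (gaussian_density x * tilt v x) * indicator A x \<partial>lborel)"
    by (simp add: emeasure_density gaussian_def nn_integral_density ennreal_mult mult.assoc tilt_pos less_imp_le)
  also have "\<dots> = (\<integral>\<^sup>+x. ennreal (gaussian_density (v + x) * tilt v (v + x)) * indicator A (v + x) \<partial>lborel)"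
    by (subst lborel_distr_plus[of v, symmetric], subst nn_integral_distr) auto
  also have "\<dots> = (\<integral>\<^sup>+x. ennreal (gaussian_density x) * indicator A (v + x) \<partial>lborel)"
    unfolding * ..
  also have "\<dots> = (\<integral>\<^sup>+x. indicator A (x + v) \<partial>gaussian)"
    by (simp add: gaussian_def nn_integral_density add.commute)
  also have "\<dots> = (\<integral>\<^sup>+x. indicator A x \<partial>?R)"
    by (subst nn_integral_distr) auto
  also have "\<dots> = emeasure ?R A"
    by simp
  finally show "emeasure ?L A = emeasure ?R A" .
qed simp

text \<open>The density is even and Lebesgue measure is invariant under reflection. The symmetry
  serves to make the Gaussian mean vanish.\<close>

lemma distr_gaussian_uminus:
  "distr gaussian borel uminus = (gaussian :: 'a::euclidean_space measure)" (is "?L = ?R")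
proof (rule measure_eqI)
  fix A :: "'a set" assume "A \<in> sets ?L"
  then have A [measurable]: "A \<in> sets borel" by simp
  have "distr lborel borel uminus = (lborel :: 'a measure)"
    using lborel_affine[of "-1" "0::'a"] by (simp add: density_1 comp_def)
  then have "emeasure ?R A = (\<integral>\<^sup>+x. ennreal (gaussian_density x) * indicator A x \<partial>distr lborel borel uminus)"
    by (simp add: emeasure_density gaussian_def)
  also have "\<dots> = (\<integral>\<^sup>+x. ennreal (gaussian_density x) * indicator A (- x) \<partial>lborel)"
    by (subst nn_integral_distr) auto
  also have "\<dots> = (\<integral>\<^sup>+x. indicator A (- x) \<partial>gaussian)"
    by (simp add: gaussian_def nn_integral_density)
  also have "\<dots> = (\<integral>\<^sup>+x. indicator A x \<partial>?L)"
    by (subst nn_integral_distr) auto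
  also have "\<dots> = emeasure ?L A"
    by simp
  finally show "emeasure ?L A = emeasure ?R A" ..
qed simp

lemma integral_gaussian_id [simp]: "(LINT x|gaussian. x) = (0 :: 'a::euclidean_space)"
proof -
  have "(LINT x|gaussian. x) = (LINT x|distr gaussian borel uminus. (x :: 'a))"
    by (simp add: distr_gaussian_uminus)
  also have "\<dots> = - (LINT x|gaussian. x)"
    by (subst integral_distr) auto
  finally show ?thesis
    by (metis eq_neg_iff_add_eq_0 scaleR_2 scaleR_eq_0_iff zero_neq_numeral)
qed

text \<open>Change of variables under the translation, in the form used throughout: a tilt as a
  weight can be traded for a shift of the argument.\<close>

lemma
  fixes h :: "'a::euclidean_space \<Rightarrow> 'b::{banach, second_countable_topology}"
  assumes h [measurable]: "h \<in> borel_measurable borel"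
    and "integrable gaussian (\<lambda>x. h (x + v))"
  shows integrable_tilt: "integrable gaussian (\<lambda>x. tilt v x *\<^sub>R h x)"
    and integral_tilt: "(LINT x|gaussian. tilt v x *\<^sub>R h x) = (LINT x|gaussian. h (x + v))"
proof -
  have "integrable (density gaussian (\<lambda>x. ennreal (tilt v x))) h"
    unfolding density_tilt using assms by (subst integrable_distr_eq) auto
  then show "integrable gaussian (\<lambda>x. tilt v x *\<^sub>R h x)"
    by (subst (asm) integrable_density) (auto simp: less_imp_le tilt_pos)
  have "(LINT x|density gaussian (\<lambda>x. ennreal (tilt v x)). h x) = (LINT x|gaussian. h (x + v))"
    unfolding density_tilt by (subst integral_distr) auto
  then show "(LINT x|gaussian. tilt v x *\<^sub>R h x) = (LINT x|gaussian. h (x + v))"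
    by (subst (asm) integral_density) (auto simp: less_imp_le tilt_pos)
qed

lemma integrable_gaussian_norm_square:
  "integrable gaussian (\<lambda>x::'a::euclidean_space. (norm (x + w))\<^sup>2)"
  using integrable_gaussian_norm_powr[of 2 w] by simp

text \<open>On expanding the square, the cross term integrates to 0 because the Gaussian is
  centered.\<close>

lemma integral_gaussian_norm_square_shift:
  "(LINT x|gaussian. (norm (x + w :: 'a::euclidean_space))\<^sup>2) = (LINT x|gaussian. (norm (x::'a))\<^sup>2) + (norm w)\<^sup>2"
proof -
  interpret prob_space "gaussian :: 'a measure" by (rule prob_space_gaussian)
  have "(LINT x|gaussian. (norm (x + w))\<^sup>2) = (LINT x|gaussian. (norm (x::'a))\<^sup>2 + 2 * (x \<bullet> w) + (norm w)\<^sup>2)"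
    by (simp add: power2_norm_eq_inner algebra_simps inner_commute)
  also have "\<dots> = (LINT x|gaussian. (norm (x::'a))\<^sup>2) + 2 * ((LINT x|gaussian. x) \<bullet> w) + (norm w)\<^sup>2"
    using integrable_gaussian_norm_square[of "0 :: 'a"] prob_space by simp
  finally show ?thesis by simp
qed

section \<open>Symmetric Gaussian mixtures\<close>

text \<open>The weight \<epsilon> is split evenly between \<open>v\<close> and \<open>- v\<close> so
  that the barycenter stays at 0.\<close>

definition mix :: "real \<Rightarrow> 'a::euclidean_space \<Rightarrow> 'a \<Rightarrow> real" where
  "mix \<epsilon> v x = (1 - \<epsilon>) + \<epsilon> / 2 * (tilt v x + tilt (- v) x)"

abbreviation mixture :: "real \<Rightarrow> 'a::euclidean_space \<Rightarrow> 'a measure" where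
  "mixture \<epsilon> v \<equiv> density gaussian (\<lambda>x. ennreal (mix \<epsilon> v x))"

lemma mix_measurable [measurable]: "mix \<epsilon> v \<in> borel_measurable borel"
  unfolding mix_def by measurable

lemma mixture_measurable [simp]:
  "measurable (mixture \<epsilon> v) M = measurable borel M"
  by (rule measurable_cong_sets) simp_all

text \<open>Both bounds are strict, so that \<open>ln (1 - \<epsilon>)\<close> and
  \<open>ln (\<epsilon> / 2)\<close> are logarithms of positive numbers and all three components
  have positive weight.\<close>

locale symmetric_mixture =
  fixes \<epsilon> :: real and v :: "'a::euclidean_space"
  assumes eps: "0 < \<epsilon>" "\<epsilon> < 1"
begin

lemma mix_pos: "0 < mix \<epsilon> v x"
  using eps tilt_pos[of v x] tilt_pos[of "- v" x] by (simp add: mix_def add_pos_pos)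

lemma mix_nonneg: "0 \<le> mix \<epsilon> v x"
  using mix_pos[of x] by simp

text \<open>By linearity, everything reduces to three Gaussian integrals, shifted by 0,
  \<open>v\<close> and \<open>- v\<close>. Moments, the mean and the total mass of the mixture are
  all instances.\<close>

lemma
  fixes h :: "'a \<Rightarrow> 'b::{banach, second_countable_topology}"
  assumes h [measurable]: "h \<in> borel_measurable borel"
    and int: "\<And>w. integrable gaussian (\<lambda>x. h (x + w))"
  shows integrable_mix: "integrable gaussian (\<lambda>x. mix \<epsilon> v x *\<^sub>R h x)"
    and integrable_mixture: "integrable (mixture \<epsilon> v) h"
    and integral_mixture: "(LINT x|mixture \<epsilon> v. h x) =
      (1 - \<epsilon>) *\<^sub>R (LINT x|gaussian. h x) +
      (\<epsilon> / 2) *\<^sub>R ((LINT x|gaussian. h (x + v)) + (LINT x|gaussian. h (x - v)))"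
proof -
  have int0: "integrable gaussian h" using int[of 0] by simp
  note t = integrable_tilt[OF h int]
  have eq: "(\<lambda>x. mix \<epsilon> v x *\<^sub>R h x) =
    (\<lambda>x. (1 - \<epsilon>) *\<^sub>R h x + (\<epsilon> / 2) *\<^sub>R (tilt v x *\<^sub>R h x + tilt (- v) x *\<^sub>R h x))"
    by (simp add: mix_def algebra_simps)
  show i: "integrable gaussian (\<lambda>x. mix \<epsilon> v x *\<^sub>R h x)"
    unfolding eq by (intro Bochner_Integration.integrable_add integrable_scaleR_right int0 t)
  show "integrable (mixture \<epsilon> v) h"
    using i by (subst integrable_density) (auto simp: mix_nonneg)
  have "(LINT x|mixture \<epsilon> v. h x) = (LINT x|gaussian. mix \<epsilon> v x *\<^sub>R h x)"
    by (subst integral_density) (auto simp: mix_nonneg)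
  also have "\<dots> = (1 - \<epsilon>) *\<^sub>R (LINT x|gaussian. h x) +
      (\<epsilon> / 2) *\<^sub>R ((LINT x|gaussian. tilt v x *\<^sub>R h x) + (LINT x|gaussian. tilt (- v) x *\<^sub>R h x))"
    unfolding eq using int0 t by simp
  also have "\<dots> = (1 - \<epsilon>) *\<^sub>R (LINT x|gaussian. h x) +
      (\<epsilon> / 2) *\<^sub>R ((LINT x|gaussian. h (x + v)) + (LINT x|gaussian. h (x - v)))"
    using integral_tilt[OF h int, of v] integral_tilt[OF h int, of "- v"] by simp
  finally show "(LINT x|mixture \<epsilon> v. h x) = \<dots>" .
qed

lemma integrable_mix_density: "integrable gaussian (mix \<epsilon> v)"
proof -
  interpret prob_space "gaussian :: 'a measure" by (rule prob_space_gaussian)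
  show ?thesis using integrable_mix[of "\<lambda>_. 1 :: real"] by simp
qed

lemma prob_space_mixture: "prob_space (mixture \<epsilon> v)"
proof -
  interpret prob_space "gaussian :: 'a measure" by (rule prob_space_gaussian)
  have "(LINT x|gaussian. mix \<epsilon> v x) = (LINT x|mixture \<epsilon> v. (1 :: real))"
    by (subst integral_density) (auto simp: mix_nonneg)
  also have "\<dots> = 1"
    using prob_space by (subst integral_mixture) (simp_all add: field_simps)
  finally have "(\<integral>\<^sup>+x. ennreal (mix \<epsilon> v x) \<partial>gaussian) = 1"
    by (subst nn_integral_eq_integral[OF integrable_mix_density]) (auto simp: mix_nonneg)
  then show ?thesis
    by (intro prob_spaceI) (simp add: emeasure_density)
qed

lemma mixture_in_wasserstein_space:
  assumes "q \<ge> 0"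
  shows "mixture \<epsilon> v \<in> wasserstein_space q"
  unfolding wasserstein_space_def
  using prob_space_mixture
    integrable_mixture[of "\<lambda>x. norm x powr q", OF _ integrable_gaussian_norm_powr[OF assms]]
  by auto

lemma centered_mixture: "centered (mixture \<epsilon> v)"
proof -
  interpret prob_space "gaussian :: 'a measure" by (rule prob_space_gaussian)
  have i: "integrable gaussian (\<lambda>x. x + w)" for w :: 'a
    by simp
  have shift: "(LINT x|gaussian. x + w) = w" for w :: 'a
    using prob_space by simp
  have "integrable (mixture \<epsilon> v) (\<lambda>x. x)"
    by (rule integrable_mixture[OF _ i]) simp
  moreover have "(LINT x|mixture \<epsilon> v. x) = (1 - \<epsilon>) *\<^sub>R (LINT x|gaussian. x) +
      (\<epsilon> / 2) *\<^sub>R ((LINT x|gaussian. x + v) + (LINT x|gaussian. x - v))"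
    by (rule integral_mixture[OF _ i]) simp
  ultimately show ?thesis
    unfolding centered_def using shift[of v] shift[of "- v"] by simp
qed

lemma integral_mixture_norm_square:
  "(LINT x|mixture \<epsilon> v. (norm x)\<^sup>2) = (LINT x|gaussian. (norm (x::'a))\<^sup>2) + \<epsilon> * (norm v)\<^sup>2"
  using integral_mixture[OF _ integrable_gaussian_norm_square]
    integral_gaussian_norm_square_shift[of v] integral_gaussian_norm_square_shift[of "- v"]
  by (simp add: field_simps)

text \<open>Since 2 v = (x + v) - (x - v), one of the two shifted points always has norm at least
  that of \<open>v\<close>. The central component is nonnegative and is dropped.\<close>

lemma integral_mixture_norm_powr:
  assumes "q > 0"
  shows "\<epsilon> / 2 * norm v powr q \<le> (LINT x|mixture \<epsilon> v. norm x powr q)"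
proof -
  interpret prob_space "gaussian :: 'a measure" by (rule prob_space_gaussian)
  have i: "integrable gaussian (\<lambda>x. norm (x + w :: 'a) powr q)" for w
    using assms by (intro integrable_gaussian_norm_powr) simp
  have "norm v powr q \<le> norm (x + v) powr q + norm (x - v) powr q" for x
  proof -
    have "2 *\<^sub>R v = (x + v) - (x - v)" by (simp add: scaleR_2)
    then have "2 * norm v \<le> norm (x + v) + norm (x - v)"
      by (metis abs_numeral norm_scaleR norm_triangle_ineq4)
    then consider "norm v \<le> norm (x + v)" | "norm v \<le> norm (x - v)" by linarith
    then show ?thesis
    proof cases
      case 1
      then have "norm v powr q \<le> norm (x + v) powr q" using assms by (intro powr_mono2) auto
      then show ?thesis by (simp add: add_increasing2)
    next
      case 2
      then have "norm v powr q \<le> norm (x - v) powr q" using assms by (intro powr_mono2) auto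
      then show ?thesis by (simp add: add_increasing)
    qed
  qed
  then have "(LINT x|(gaussian::'a measure). norm v powr q) \<le>
      (LINT x|gaussian. norm (x + v) powr q + norm (x - v) powr q)"
    using i[of v] i[of "- v"] by (intro integral_mono) auto
  then have "norm v powr q \<le> (LINT x|gaussian. norm (x + v) powr q) + (LINT x|gaussian. norm (x - v) powr q)"
    using i[of v] i[of "- v"] prob_space by simp
  then have "\<epsilon> / 2 * norm v powr q \<le>
      \<epsilon> / 2 * ((LINT x|gaussian. norm (x + v) powr q) + (LINT x|gaussian. norm (x - v) powr q))"
    using eps by (intro mult_left_mono) auto
  moreover have "0 \<le> (1 - \<epsilon>) * (LINT x|gaussian. norm (x::'a) powr q)"
    using eps by (intro mult_nonneg_nonneg integral_nonneg) auto
  ultimately show ?thesis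
    using integral_mixture[OF _ i] by simp
qed

section \<open>Relative entropy of the mixture\<close>

text \<open>The integrand f ln f is enclosed pointwise between two explicit integrable functions
  \<open>lo\<close> and \<open>up\<close>. This yields its integrability, hence finiteness of the
  entropy, together with both bounds. The gap between the bounds depends on \<epsilon> only.\<close>

lemma rel_entropy_mixture:
  obtains H where "rel_entropy (mixture \<epsilon> v) = ereal H"
    and "H \<le> \<epsilon> * (norm v)\<^sup>2 / 2"
    and "\<epsilon> * (norm v)\<^sup>2 / 2 + (1 - \<epsilon>) * ln (1 - \<epsilon>) + \<epsilon> * ln (\<epsilon> / 2) \<le> H"
proof -
  interpret prob_space "gaussian :: 'a measure" by (rule prob_space_gaussian)
  let ?f = "mix \<epsilon> v"
  define l where "l w x = w \<bullet> x - (norm w)\<^sup>2 / 2" for w x :: 'a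
  have ln_tilt: "ln (tilt w x) = l w x" for w x by (simp add: tilt_def l_def)
  have [measurable]: "l w \<in> borel_measurable borel" for w unfolding l_def by measurable
  have l_shift: "integrable gaussian (\<lambda>x. l w (x + u))" for w u
    unfolding l_def inner_add_right by simp
  have "(LINT x|gaussian. l w (x + w)) = (norm w)\<^sup>2 / 2" for w
  proof -
    have "(LINT x|gaussian. l w (x + w)) = (LINT x|gaussian. w \<bullet> x + (norm w)\<^sup>2 / 2)"
      by (simp add: l_def inner_add_right power2_norm_eq_inner)
    also have "\<dots> = w \<bullet> (LINT x|gaussian. x) + (norm w)\<^sup>2 / 2"
      using prob_space by simp
    finally show ?thesis by simp
  qed
  then have l_int: "(LINT x|gaussian. tilt w x * l w x) = (norm w)\<^sup>2 / 2" for w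
    using integral_tilt[OF _ l_shift, of w w] by simp
  have l_i: "integrable gaussian (\<lambda>x. tilt w x * l w x)" for w
    using integrable_tilt[OF _ l_shift, of w w] by simp
  have t_i: "integrable gaussian (tilt w)" and t_int: "(LINT x|gaussian. tilt w x) = 1" for w :: 'a
    using integrable_tilt[of "\<lambda>_. 1 :: real" w] integral_tilt[of "\<lambda>_. 1 :: real" w] prob_space by simp_all
  \<comment> \<open>\<open>up\<close> is the weighted sum of s ln s over the three component
    densities. The central component has density 1 and contributes 0.\<close>
  define up where "up x = \<epsilon> / 2 * (tilt v x * l v x + tilt (- v) x * l (- v) x)" for x
  define lo where "lo x = up x + (1 - \<epsilon>) * ln (1 - \<epsilon>) + \<epsilon> / 2 * ln (\<epsilon> / 2) * (tilt v x + tilt (- v) x)" for x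
  have up: "integrable gaussian up" "(LINT x|gaussian. up x) = \<epsilon> * (norm v)\<^sup>2 / 2"
    unfolding up_def using l_i by (simp_all add: l_int)
  have lo: "integrable gaussian lo"
    "(LINT x|gaussian. lo x) = \<epsilon> * (norm v)\<^sup>2 / 2 + (1 - \<epsilon>) * ln (1 - \<epsilon>) + \<epsilon> * ln (\<epsilon> / 2)"
    unfolding lo_def using up t_i prob_space by (simp_all add: t_int)
  have f_le: "?f x * ln (?f x) \<le> up x" for x
  proof -
    \<comment> \<open>The tangent line bound ln s \<le> s - 1 at s = z / y; it serves in place of
      convexity of s ln s.\<close>
    have gibbs: "y * ln z \<le> y * ln y + z - y" if "y > 0" "z > 0" for y z :: real
    proof -
      have "y * ln (z / y) \<le> y * (z / y - 1)"
        using that by (intro mult_left_mono ln_le_minus_one) auto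
      then show ?thesis using that by (simp add: ln_div algebra_simps)
    qed
    have "(1 - \<epsilon>) * (1 * ln (?f x)) \<le> (1 - \<epsilon>) * (1 * ln 1 + ?f x - 1)"
      using eps mix_pos[of x] by (intro mult_left_mono gibbs) auto
    moreover have "\<epsilon> / 2 * (tilt w x * ln (?f x)) \<le> \<epsilon> / 2 * (tilt w x * l w x + ?f x - tilt w x)" for w
      using eps mix_pos[of x] tilt_pos[of w x] unfolding ln_tilt[symmetric]
      by (intro mult_left_mono gibbs) auto
    note this[of v] this[of "- v"]
    \<comment> \<open>The corrections F - 1, F - s and F - t cancel in the weighted sum, because F
      is the average of 1, s and t with exactly these weights.\<close>
    moreover have "F * L \<le> \<epsilon> / 2 * (a + b)"
      if F: "F = (1 - \<epsilon>) + \<epsilon> / 2 * (s + t)"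
        and "(1 - \<epsilon>) * (1 * L) \<le> (1 - \<epsilon>) * (1 * ln 1 + F - 1)"
        and "\<epsilon> / 2 * (s * L) \<le> \<epsilon> / 2 * (a + F - s)"
        and "\<epsilon> / 2 * (t * L) \<le> \<epsilon> / 2 * (b + F - t)" for F L a b s t
    proof -
      have "F * L = (1 - \<epsilon>) * (1 * L) + \<epsilon> / 2 * (s * L) + \<epsilon> / 2 * (t * L)"
        unfolding F by (simp add: algebra_simps)
      also have "\<dots> \<le> (1 - \<epsilon>) * (1 * ln 1 + F - 1) + \<epsilon> / 2 * (a + F - s) + \<epsilon> / 2 * (b + F - t)"
        by (intro add_mono that)
      also have "\<dots> = F - ((1 - \<epsilon>) + \<epsilon> / 2 * (s + t)) + \<epsilon> / 2 * (a + b)"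
        by (simp add: field_simps)
      finally show ?thesis unfolding F by simp
    qed
    ultimately show ?thesis unfolding up_def using mix_def by blast
  qed
  have f_ge: "lo x \<le> ?f x * ln (?f x)" for x
  proof -
    have "ln (1 - \<epsilon>) \<le> ln (?f x)"
      using eps tilt_pos[of v x] tilt_pos[of "- v" x] by (intro ln_mono) (auto simp: mix_def add_pos_pos)
    then have 1: "(1 - \<epsilon>) * ln (1 - \<epsilon>) \<le> (1 - \<epsilon>) * ln (?f x)"
      using eps by (intro mult_left_mono) auto
    have 2: "\<epsilon> / 2 * (tilt w x * (ln (\<epsilon> / 2) + l w x)) \<le> \<epsilon> / 2 * (tilt w x * ln (?f x))"
      if "w = v \<or> w = - v" for w
    proof -
      have "0 \<le> \<epsilon> / 2 * tilt v x" "0 \<le> \<epsilon> / 2 * tilt (- v) x"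
        using eps tilt_pos[of v x] tilt_pos[of "- v" x] by simp_all
      \<comment> \<open>A sum of nonnegative components is at least each of them, and ln is
        monotone. The logarithm of a single weighted tilt is affine in \<open>x\<close>.\<close>
      then have "\<epsilon> / 2 * tilt w x \<le> ?f x"
        using eps that by (auto simp: mix_def distrib_left)
      then have "ln (\<epsilon> / 2 * tilt w x) \<le> ln (?f x)"
        using eps tilt_pos[of w x] by (intro ln_mono) auto
      also have "ln (\<epsilon> / 2 * tilt w x) = ln (\<epsilon> / 2) + l w x"
        using eps tilt_pos[of w x] by (subst ln_mult) (auto simp: ln_tilt)
      finally show ?thesis
        using eps tilt_pos[of w x] by (intro mult_left_mono) auto
    qed
    have "lo x = (1 - \<epsilon>) * ln (1 - \<epsilon>) + \<epsilon> / 2 * (tilt v x * (ln (\<epsilon> / 2) + l v x)) +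
        \<epsilon> / 2 * (tilt (- v) x * (ln (\<epsilon> / 2) + l (- v) x))"
      by (simp add: lo_def up_def algebra_simps)
    also have "\<dots> \<le> (1 - \<epsilon>) * ln (?f x) + \<epsilon> / 2 * (tilt v x * ln (?f x)) + \<epsilon> / 2 * (tilt (-v) x * ln (?f x))"
      by (intro add_mono 1 2) simp_all
    also have "\<dots> = ((1 - \<epsilon>) + \<epsilon> / 2 * (tilt v x + tilt (-v) x)) * ln (?f x)"
      by (simp add: algebra_simps)
    finally show ?thesis unfolding mix_def .
  qed
  have f_i: "integrable gaussian (\<lambda>x. ?f x * ln (?f x))"
  proof (rule Bochner_Integration.integrable_bound)
    show "integrable gaussian (\<lambda>x. \<bar>up x\<bar> + \<bar>lo x\<bar>)" using up lo by auto
    have "\<bar>?f x * ln (?f x)\<bar> \<le> \<bar>\<bar>up x\<bar> + \<bar>lo x\<bar>\<bar>" for x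
      using f_le[of x] f_ge[of x] by linarith
    then show "AE x in gaussian. norm (?f x * ln (?f x)) \<le> norm (\<bar>up x\<bar> + \<bar>lo x\<bar>)" by simp
  qed simp
  \<comment> \<open>The entropy is defined through \<open>RN_deriv\<close>, which agrees with the
    explicit density only almost everywhere, so the results are transferred from \<open>?f\<close>
    to \<open>r\<close>.\<close>
  define r where "r x = enn2real (RN_deriv gaussian (mixture \<epsilon> v) x)" for x
  have [measurable]: "r \<in> borel_measurable borel" unfolding r_def
    using borel_measurable_RN_deriv[of gaussian "mixture \<epsilon> v"] by simp
  have "AE x in gaussian. ennreal (?f x) = RN_deriv gaussian (mixture \<epsilon> v) x"
    by (rule RN_deriv_unique) auto
  then have r: "AE x in gaussian. r x = ?f x"
    by eventually_elim (metis enn2real_ennreal mix_nonneg r_def)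
  have r_i: "integrable gaussian (\<lambda>x. r x * ln (r x))"
    using r by (intro integrable_cong_AE_imp[OF f_i]) auto
  have r_int: "(LINT x|gaussian. r x * ln (r x)) = (LINT x|gaussian. ?f x * ln (?f x))"
    using r by (intro integral_cong_AE) auto
  show thesis
  proof
    show "rel_entropy (mixture \<epsilon> v) = ereal (LINT x|gaussian. ?f x * ln (?f x))"
      using r_i r_int unfolding rel_entropy_def r_def by (simp add: Let_def)
    show "(LINT x|gaussian. ?f x * ln (?f x)) \<le> \<epsilon> * (norm v)\<^sup>2 / 2"
      unfolding up(2)[symmetric] by (intro integral_mono f_i up f_le)
    show "\<epsilon> * (norm v)\<^sup>2 / 2 + (1 - \<epsilon>) * ln (1 - \<epsilon>) + \<epsilon> * ln (\<epsilon> / 2) \<le> (LINT x|gaussian. ?f x * ln (?f x))"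
      unfolding lo(2)[symmetric] by (intro integral_mono f_i lo f_ge)
  qed
qed

end

section \<open>Couplings\<close>

text \<open>The norm of the sum is at most twice the larger norm. The constant is crude but covers
  all exponents \<open>q \<ge> 0\<close> at once.\<close>

lemma norm_add_powr_le:
  fixes x y :: "'a::real_normed_vector"
  assumes "q \<ge> 0"
  shows "norm (x + y) powr q \<le> 2 powr q * (norm x powr q + norm y powr q)"
proof -
  have "norm (x + y) powr q \<le> (2 * max (norm x) (norm y)) powr q"
    using assms by (intro powr_mono2) (auto intro: norm_triangle_le)
  also have "\<dots> = 2 powr q * max (norm x) (norm y) powr q"
    by (simp add: powr_mult)
  also have "\<dots> \<le> 2 powr q * (norm x powr q + norm y powr q)"
    by (simp add: max_def)
  finally show ?thesis .
qed

text \<open>A function of one coordinate sees only the corresponding marginal. Lower bounds on the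
  cost by sums of such functions therefore hold uniformly over all couplings.\<close>

lemma
  fixes h :: "'a::euclidean_space \<Rightarrow> 'b::{banach, second_countable_topology}"
  assumes \<pi>: "\<pi> \<in> couplings \<mu> \<nu>" and h: "h \<in> borel_measurable borel"
  shows integrable_coupling_fst: "integrable \<mu> h \<Longrightarrow> integrable \<pi> (\<lambda>z. h (fst z))"
    and integrable_coupling_snd: "integrable \<nu> h \<Longrightarrow> integrable \<pi> (\<lambda>z. h (snd z))"
    and integral_coupling_fst: "(LINT z|\<pi>. h (fst z)) = (LINT x|\<mu>. h x)"
    and integral_coupling_snd: "(LINT z|\<pi>. h (snd z)) = (LINT x|\<nu>. h x)"
proof -
  have sets [measurable_cong]: "sets \<pi> = sets borel" and \<mu>: "\<mu> = distr \<pi> borel fst" and \<nu>: "\<nu> = distr \<pi> borel snd"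
    using \<pi> by (auto simp: couplings_def)
  have [measurable]: "fst \<in> borel_measurable \<pi>" "snd \<in> borel_measurable \<pi>"
    unfolding measurable_cong_sets[OF sets refl]
    by (intro borel_measurable_continuous_onI continuous_intros)+
  show "integrable \<mu> h \<Longrightarrow> integrable \<pi> (\<lambda>z. h (fst z))"
    "integrable \<nu> h \<Longrightarrow> integrable \<pi> (\<lambda>z. h (snd z))"
    "(LINT z|\<pi>. h (fst z)) = (LINT x|\<mu>. h x)"
    "(LINT z|\<pi>. h (snd z)) = (LINT x|\<nu>. h x)"
    unfolding \<mu> \<nu> using h by (simp_all add: integrable_distr_eq integral_distr)
qed

text \<open>The Bochner integral of a nonintegrable function is 0 by default, so integrability must
  be known before the cost can be bounded below by monotonicity.\<close>

lemma integrable_coupling_cost: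
  fixes \<mu> \<nu> :: "'a::euclidean_space measure"
  assumes "q \<ge> 0" "\<mu> \<in> wasserstein_space q" "\<nu> \<in> wasserstein_space q"
    and \<pi>: "\<pi> \<in> couplings \<mu> \<nu>"
  shows "integrable \<pi> (\<lambda>z. norm (fst z - snd z) powr q)"
proof (rule Bochner_Integration.integrable_bound)
  have i: "integrable \<mu> (\<lambda>x. norm x powr q)" "integrable \<nu> (\<lambda>x. norm x powr q)"
    using assms by (simp_all add: wasserstein_space_def)
  show "integrable \<pi> (\<lambda>z. 2 powr q * (norm (fst z) powr q + norm (snd z) powr q))"
    by (intro integrable_mult_right Bochner_Integration.integrable_add
        integrable_coupling_fst[OF \<pi> _ i(1)] integrable_coupling_snd[OF \<pi> _ i(2)]) auto
  have sets: "sets \<pi> = sets borel" using \<pi> by (simp add: couplings_def)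
  show "(\<lambda>z. norm (fst z - snd z) powr q) \<in> borel_measurable \<pi>"
    unfolding measurable_cong_sets[OF sets refl]
    by (intro powr_real_measurable borel_measurable_continuous_onI continuous_intros)
  have "norm (x - y) powr q \<le> 2 powr q * (norm x powr q + norm y powr q)" for x y :: 'a
    using norm_add_powr_le[OF assms(1), of x "- y"] by simp
  then show "AE z in \<pi>. norm (norm (fst z - snd z) powr q) \<le>
      norm (2 powr q * (norm (fst z) powr q + norm (snd z) powr q))"
    by simp
qed

text \<open>Nonemptiness of the set of couplings is what makes a uniform lower bound pass to the
  real-valued infimum.\<close>

lemma wasserstein_ge:
  assumes "p > 0" "0 \<le> c" "couplings \<mu> \<nu> \<noteq> {}"
    and "\<And>\<pi>. \<pi> \<in> couplings \<mu> \<nu> \<Longrightarrow> c \<le> (LINT z|\<pi>. norm (fst z - snd z) powr p)"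
  shows "c powr (1 / p) \<le> wasserstein p \<mu> \<nu>"
  unfolding wasserstein_def using assms by (intro cINF_greatest powr_mono2) auto

lemma wasserstein_le:
  assumes "\<pi> \<in> couplings \<mu> \<nu>"
  shows "wasserstein p \<mu> \<nu> \<le> (LINT z|\<pi>. norm (fst z - snd z) powr p) powr (1 / p)"
  unfolding wasserstein_def using assms
  by (intro cINF_lower bdd_belowI2[where m = 0]) auto

lemma gaussian_in_wasserstein_space:
  "q \<ge> 0 \<Longrightarrow> (gaussian :: 'a::euclidean_space measure) \<in> wasserstein_space q"
  using prob_space_gaussian integrable_gaussian_norm_powr[of q 0]
  by (simp add: wasserstein_space_def)

text \<open>
  The subtracted terms have small integrals although the part of the mixture near $\pm v$ may have
  an unbounded second moment. Truncating at 0 makes the central part contribute nonnegatively.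
\<close>

lemma square_diff_ge:
  fixes t u w :: real
  assumes "t > 0" "u \<ge> 0" "w \<ge> 0"
  shows "max 0 (u\<^sup>2 - 2 * t * u) - u\<^sup>2 / (t ^ j)\<^sup>2 - w ^ (2 * (j + 2)) / t\<^sup>2 \<le> (u - w)\<^sup>2"
proof -
  have w: "w \<le> t + w ^ (j + 2) / t ^ (j + 1)"
  proof (cases "w \<le> t")
    case False
    then have "w * t ^ (j + 1) \<le> w * w ^ (j + 1)"
      using assms by (intro mult_left_mono power_mono) auto
    then have "w \<le> w ^ (j + 2) / t ^ (j + 1)"
      using assms by (simp add: pos_le_divide_eq)
    then show ?thesis using assms by linarith
  qed (use assms in \<open>auto intro: add_increasing2\<close>)
  \<comment> \<open>The product of \<open>r\<close> and \<open>s\<close> is u w^(j+2) / t^(j+1), so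
    2 r s \<le> r^2 + s^2 separates the two variables.\<close>
  define r s where "r = u / t ^ j" and "s = w ^ (j + 2) / t"
  have "2 * u * w \<le> 2 * u * (t + w ^ (j + 2) / t ^ (j + 1))"
    using assms w by (intro mult_left_mono) auto
  also have "\<dots> = 2 * t * u + 2 * r * s"
    using assms by (simp add: r_def s_def field_simps)
  finally have "2 * u * w \<le> 2 * t * u + (r\<^sup>2 + s\<^sup>2)"
    using sum_squares_bound[of r s] by linarith
  moreover have "r\<^sup>2 = u\<^sup>2 / (t ^ j)\<^sup>2" "s\<^sup>2 = w ^ (2 * (j + 2)) / t\<^sup>2"
    by (simp_all only: r_def s_def power_divide power_mult[symmetric] mult.commute[of _ 2])
  moreover have "(u - w)\<^sup>2 \<ge> u\<^sup>2 - 2 * u * w"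
    by (simp add: power2_diff)
  moreover have "0 \<le> (u - w)\<^sup>2" "0 \<le> r\<^sup>2" "0 \<le> s\<^sup>2"
    by simp_all
  ultimately show ?thesis unfolding max_def by (simp only: split: if_split) linarith
qed

section \<open>Transport cost between the mixture and the Gaussian\<close>

context symmetric_mixture
begin

text \<open>Take X Gaussian and an independent random sign S with values 0, 1, -1. The pair (X + S
  v, X) has the required marginals, and its cost is the second moment \<epsilon> of S times the
  square of the norm of \<open>v\<close>.\<close>

lemma mixture_coupling:
  obtains \<pi> where "\<pi> \<in> couplings (mixture \<epsilon> v) gaussian"
    and "(LINT z|\<pi>. norm (fst z - snd z) powr 2) = \<epsilon> * (norm v)\<^sup>2"
proof -
  interpret G: prob_space "gaussian :: 'a measure" by (rule prob_space_gaussian)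
  interpret Mx: prob_space "mixture \<epsilon> v" by (rule prob_space_mixture)
  \<comment> \<open>Two coin flips: the first, with probability \<epsilon>, decides whether to shift
    at all, and a fair one chooses the sign.\<close>
  define S :: "real pmf" where
    "S = bernoulli_pmf \<epsilon> \<bind> (\<lambda>b. if b then map_pmf (\<lambda>c. if c then 1 else - 1) (bernoulli_pmf (1 / 2)) else return_pmf 0)"
  have S: "(\<integral>\<^sup>+s. ennreal (h s) \<partial>S) = ennreal ((1 - \<epsilon>) * h 0 + \<epsilon> / 2 * (h 1 + h (- 1)))"
    if h: "\<And>s. 0 \<le> h s" for h :: "real \<Rightarrow> real"
  proof -
    have "(\<integral>\<^sup>+s. ennreal (h s) \<partial>S) =
      (ennreal (h 1) * ennreal (1 / 2) + ennreal (h (- 1)) * ennreal (1 / 2)) * ennreal \<epsilon> +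
        ennreal (h 0) * ennreal (1 - \<epsilon>)"
      using eps unfolding S_def
      by (simp only: nn_integral_bind_pmf) (simp add: nn_integral_bernoulli_pmf)
    also have "\<dots> = ennreal ((h 1 * (1 / 2) + h (- 1) * (1 / 2)) * \<epsilon> + h 0 * (1 - \<epsilon>))"
    proof -
      have *: "(ennreal a * ennreal d + ennreal b * ennreal d) * ennreal e + ennreal c * ennreal g =
          ennreal ((a * d + b * d) * e + c * g)"
        if "0 \<le> a" "0 \<le> b" "0 \<le> c" "0 \<le> d" "0 \<le> e" "0 \<le> g" for a b c d e g :: real
        using that by (simp add: ennreal_mult ennreal_plus)
      show ?thesis by (rule *) (use eps h in auto)
    qed
    finally show ?thesis by (simp add: algebra_simps)
  qed
  define P where "P = (gaussian :: 'a measure) \<Otimes>\<^sub>M measure_pmf S"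
  interpret P: pair_prob_space "gaussian :: 'a measure" "measure_pmf S" ..
  \<comment> \<open>\<open>measure_pmf S\<close> carries the discrete sigma-algebra on the reals, so
    measurability of the coordinate maps into \<open>borel\<close> is derived from this product
    form.\<close>
  have sets_P [measurable_cong]: "sets P = sets (borel \<Otimes>\<^sub>M count_space UNIV)"
    unfolding P_def by (intro sets_pair_measure_cong) simp_all
  have [measurable]: "(\<lambda>z. snd z) \<in> borel_measurable (borel \<Otimes>\<^sub>M count_space (UNIV :: real set))"
    by (rule measurable_compose[OF measurable_snd]) simp
  have m1 [measurable]: "(\<lambda>z. fst z + snd z *\<^sub>R v) \<in> borel_measurable P"
    and m2 [measurable]: "fst \<in> borel_measurable P" and m3 [measurable]: "snd \<in> borel_measurable P"
    unfolding measurable_cong_sets[OF sets_P refl] by measurable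
  \<comment> \<open>Fubini: for fixed \<open>x\<close> the inner integral over \<open>S\<close> is a
    sum of three terms.\<close>
  have P_int: "(\<integral>\<^sup>+z. ennreal (h z) \<partial>P) =
      (\<integral>\<^sup>+x. ennreal ((1 - \<epsilon>) * h (x, 0) + \<epsilon> / 2 * (h (x, 1) + h (x, - 1))) \<partial>gaussian)"
    if "h \<in> borel_measurable P" "\<And>z. 0 \<le> h z" for h
  proof -
    have "(\<integral>\<^sup>+z. ennreal (h z) \<partial>P) = (\<integral>\<^sup>+x. \<integral>\<^sup>+s. ennreal (h (x, s)) \<partial>S \<partial>gaussian)"
      using that unfolding P_def by (subst measure_pmf.nn_integral_fst) auto
    then show ?thesis using that(2) by (simp add: S)
  qed
  define \<pi> where "\<pi> = distr P borel (\<lambda>z. (fst z + snd z *\<^sub>R v, fst z))"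
  have m4 [measurable]: "(\<lambda>z. (fst z + snd z *\<^sub>R v, fst z)) \<in> measurable P borel"
    by (rule borel_measurable_Pair) measurable
  have fst_meas: "(fst :: 'a \<times> 'a \<Rightarrow> 'a) \<in> borel_measurable borel" and snd_meas: "(snd :: 'a \<times> 'a \<Rightarrow> 'a) \<in> borel_measurable borel"
    by (intro borel_measurable_continuous_onI continuous_intros)+
  have "prob_space P" unfolding P_def by (rule P.P.prob_space_axioms)
  then have "prob_space \<pi>" unfolding \<pi>_def by (rule prob_space.prob_space_distr) measurable
  moreover have "distr \<pi> borel fst = mixture \<epsilon> v"
  proof (rule measure_eqI)
    fix A assume "A \<in> sets (distr \<pi> borel fst)"
    then have A [measurable]: "A \<in> sets borel" by simp
    let ?I = "indicator A :: 'a \<Rightarrow> real"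
    have i: "integrable gaussian (\<lambda>x. ?I (x + w))" for w
      by (rule G.integrable_const_bound[where B = 1]) (auto simp: indicator_def)
    have i0: "integrable gaussian ?I" using i[of 0] by simp
    have i': "integrable gaussian (\<lambda>x. ?I (x - v))" using i[of "- v"] by simp
    have "distr \<pi> borel fst = distr P borel (\<lambda>z. fst z + snd z *\<^sub>R v)"
      unfolding \<pi>_def by (subst distr_distr[OF fst_meas m4]) (simp add: comp_def)
    then have "emeasure (distr \<pi> borel fst) A = (\<integral>\<^sup>+z. indicator A z \<partial>distr P borel (\<lambda>z. fst z + snd z *\<^sub>R v))"
      by simp
    also have "\<dots> = (\<integral>\<^sup>+z. ennreal (?I (fst z + snd z *\<^sub>R v)) \<partial>P)"
      by (subst nn_integral_distr) (auto intro!: nn_integral_cong simp: ennreal_indicator)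
    also have "\<dots> = (\<integral>\<^sup>+x. ennreal ((1 - \<epsilon>) * ?I x + \<epsilon> / 2 * (?I (x + v) + ?I (x - v))) \<partial>gaussian)"
      by (subst P_int) auto
    also have "\<dots> = ennreal (LINT x|gaussian. (1 - \<epsilon>) * ?I x + \<epsilon> / 2 * (?I (x + v) + ?I (x - v)))"
      using eps i0 i[of v] i' by (intro nn_integral_eq_integral) auto
    also have "(LINT x|gaussian. (1 - \<epsilon>) * ?I x + \<epsilon> / 2 * (?I (x + v) + ?I (x - v))) =
        (LINT x|mixture \<epsilon> v. ?I x)"
      using integral_mixture[of ?I, OF _ i] i0 i[of v] i' by simp
    also have "ennreal \<dots> = emeasure (mixture \<epsilon> v) A"
      by (simp add: Mx.emeasure_eq_measure)
    finally show "emeasure (distr \<pi> borel fst) A = emeasure (mixture \<epsilon> v) A" .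
  qed simp
  moreover have "distr \<pi> borel snd = gaussian"
  proof -
    have "distr \<pi> borel snd = distr P borel fst"
      unfolding \<pi>_def by (subst distr_distr[OF snd_meas m4]) (simp add: comp_def)
    also have "\<dots> = distr P gaussian fst"
      by (rule distr_cong) simp_all
    also have "\<dots> = gaussian"
      unfolding P_def by (rule measure_pmf.distr_pair_fst)
    finally show ?thesis .
  qed
  ultimately have "\<pi> \<in> couplings (mixture \<epsilon> v) gaussian"
    by (simp add: couplings_def \<pi>_def)
  moreover have "(LINT z|\<pi>. norm (fst z - snd z) powr 2) = \<epsilon> * (norm v)\<^sup>2"
  proof -
    have "(\<lambda>z. norm (fst z - snd z) powr 2) \<in> borel_measurable (borel :: ('a \<times> 'a) measure)"
      by (intro powr_real_measurable borel_measurable_continuous_onI continuous_intros)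
    then have "(LINT z|\<pi>. norm (fst z - snd z) powr 2) = (LINT z|P. (snd z)\<^sup>2 * (norm v)\<^sup>2)"
      unfolding \<pi>_def by (subst integral_distr[OF m4]) (auto simp: power_mult_distrib)
    also have "\<dots> = enn2real (\<integral>\<^sup>+z. ennreal ((snd z)\<^sup>2 * (norm v)\<^sup>2) \<partial>P)"
      by (intro integral_eq_nn_integral) auto
    also have "(\<integral>\<^sup>+z. ennreal ((snd z)\<^sup>2 * (norm v)\<^sup>2) \<partial>P) = ennreal (\<epsilon> * (norm v)\<^sup>2)"
      using G.emeasure_space_1 by (subst P_int) auto
    finally show ?thesis using eps by simp
  qed
  ultimately show thesis by (rule that)
qed

lemma wasserstein_2_mixture_le:
  "(wasserstein 2 (mixture \<epsilon> v) gaussian)\<^sup>2 \<le> \<epsilon> * (norm v)\<^sup>2"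
proof -
  obtain \<pi> where \<pi>: "\<pi> \<in> couplings (mixture \<epsilon> v) gaussian"
    "(LINT z|\<pi>. norm (fst z - snd z) powr 2) = \<epsilon> * (norm v)\<^sup>2"
    by (rule mixture_coupling)
  have nn: "0 \<le> \<epsilon> * (norm v)\<^sup>2" using eps by simp
  have "wasserstein 2 (mixture \<epsilon> v) gaussian \<le> sqrt (\<epsilon> * (norm v)\<^sup>2)"
    using wasserstein_le[OF \<pi>(1), of 2] nn unfolding \<pi>(2) by (simp add: powr_half_sqrt)
  \<comment> \<open>Squaring the upper bound requires nonnegativity, which is the lower bound for
    the constant 0.\<close>
  moreover have "0 \<le> wasserstein 2 (mixture \<epsilon> v) gaussian"
    using wasserstein_ge[of 2 0 "mixture \<epsilon> v" gaussian] \<pi>(1) by fastforce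
  ultimately have "(wasserstein 2 (mixture \<epsilon> v) gaussian)\<^sup>2 \<le> (sqrt (\<epsilon> * (norm v)\<^sup>2))\<^sup>2"
    by (intro power_mono)
  then show ?thesis using nn by simp
qed

text \<open>\<open>square_diff_ge\<close>, applied to the norms of the two coordinates, is
  integrated over an arbitrary coupling. Each term depends on one coordinate, so the result involves
  only the marginals.\<close>

lemma wasserstein_2_mixture_ge:
  fixes j :: nat and t :: real
  assumes t: "t > 0" and v: "norm v = t ^ j"
  shows "\<epsilon> * (norm v)\<^sup>2 - 2 * t * \<epsilon> * ((LINT x|gaussian. norm (x::'a)) + norm v) -
      ((LINT x|gaussian. (norm (x::'a))\<^sup>2) / (norm v)\<^sup>2 + \<epsilon>) -
      (LINT x|gaussian. norm (x::'a) ^ (2 * (j + 2))) / t\<^sup>2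
    \<le> (wasserstein 2 (mixture \<epsilon> v) gaussian)\<^sup>2" (is "?c \<le> _")
proof -
  interpret G: prob_space "gaussian :: 'a measure" by (rule prob_space_gaussian)
  \<comment> \<open>The truncation makes \<open>h\<close> nonnegative, so the central component
    cannot lower its integral; at the shifted components the untruncated expression
    suffices.\<close>
  define h where "h x = max 0 ((norm x)\<^sup>2 - 2 * t * norm x)" for x :: 'a
  have h_meas [measurable]: "h \<in> borel_measurable borel" unfolding h_def by measurable
  have n1: "integrable gaussian (\<lambda>x::'a. norm (x + w))" for w
    using integrable_gaussian_norm_powr[of 1 w] by simp
  have n2: "integrable gaussian (\<lambda>x. (norm (x + w :: 'a))\<^sup>2)" for w
    by (rule integrable_gaussian_norm_square)
  have i: "integrable gaussian (\<lambda>x. h (x + w))" for w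
    unfolding h_def using n1[of w] n2[of w] by (intro integrable_max) auto
  have h_int: "(LINT x|gaussian. h (x + w)) \<ge> (norm w)\<^sup>2 - 2 * t * ((LINT x|gaussian. norm (x::'a)) + norm w)" for w
  proof -
    have "(LINT x|gaussian. norm (x + w)) \<le> (LINT x|gaussian. norm (x::'a) + norm w)"
      using n1[of w] by (intro integral_mono) (auto intro: norm_triangle_ineq)
    then have "2 * t * (LINT x|gaussian. norm (x + w)) \<le> 2 * t * ((LINT x|gaussian. norm (x::'a)) + norm w)"
      using t G.prob_space by (intro mult_left_mono) auto
    moreover have "0 \<le> (LINT x|gaussian. (norm (x::'a))\<^sup>2)" by simp
    ultimately have "(norm w)\<^sup>2 - 2 * t * ((LINT x|gaussian. norm (x::'a)) + norm w) \<le>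
        (LINT x|gaussian. (norm (x + w))\<^sup>2) - 2 * t * (LINT x|gaussian. norm (x + w))"
      unfolding integral_gaussian_norm_square_shift by linarith
    also have "\<dots> = (LINT x|gaussian. (norm (x + w))\<^sup>2 - 2 * t * norm (x + w))"
      using n1[of w] n2[of w] by simp
    also have "\<dots> \<le> (LINT x|gaussian. h (x + w))"
      using n1[of w] n2[of w] i[of w] by (intro integral_mono) (auto simp: h_def)
    finally show ?thesis .
  qed
  have "\<epsilon> / 2 * (2 * ((norm v)\<^sup>2 - 2 * t * ((LINT x|gaussian. norm (x::'a)) + norm v))) \<le>
      \<epsilon> / 2 * ((LINT x|gaussian. h (x + v)) + (LINT x|gaussian. h (x - v)))"
    using eps h_int[of v] h_int[of "- v"] by (intro mult_left_mono) auto
  moreover have "0 \<le> (1 - \<epsilon>) * (LINT x|gaussian. h x)"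
    using eps by (intro mult_nonneg_nonneg integral_nonneg) (auto simp: h_def)
  ultimately have hm: "\<epsilon> * (norm v)\<^sup>2 - 2 * t * \<epsilon> * ((LINT x|gaussian. norm (x::'a)) + norm v) \<le> (LINT x|mixture \<epsilon> v. h x)"
    unfolding integral_mixture[of h, OF h_meas i] by (simp add: algebra_simps)
  have h_mix: "integrable (mixture \<epsilon> v) h" by (rule integrable_mixture[OF h_meas i])
  have sq_mix: "integrable (mixture \<epsilon> v) (\<lambda>x. (norm x)\<^sup>2)" by (rule integrable_mixture[OF _ n2]) simp
  have cost: "?c \<le> (LINT z|\<pi>. norm (fst z - snd z) powr 2)"
    if \<pi>: "\<pi> \<in> couplings (mixture \<epsilon> v) gaussian" for \<pi>
  proof -
    \<comment> \<open>Nonvanishing of \<open>t ^ j\<close> allows the squared norm of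
      \<open>v\<close> to cancel in the second moment of the mixture, which leaves the summand
      \<epsilon>.\<close>
    have "t ^ j \<noteq> 0" using t by simp
    then have "?c \<le> (LINT x|mixture \<epsilon> v. h x) - (LINT x|mixture \<epsilon> v. (norm x)\<^sup>2) / (t ^ j)\<^sup>2 -
        (LINT x|gaussian. norm (x::'a) ^ (2 * (j + 2))) / t\<^sup>2"
      using hm unfolding integral_mixture_norm_square v by (simp add: add_divide_distrib)
    also have "\<dots> = (LINT z|\<pi>. h (fst z) - (norm (fst z))\<^sup>2 / (t ^ j)\<^sup>2 - norm (snd z) ^ (2 * (j + 2)) / t\<^sup>2)"
    proof -
      have "integrable \<pi> (\<lambda>z. h (fst z))" "(LINT z|\<pi>. h (fst z)) = (LINT x|mixture \<epsilon> v. h x)"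
        using integrable_coupling_fst[OF \<pi> h_meas h_mix] integral_coupling_fst[OF \<pi> h_meas] .
      moreover have "integrable \<pi> (\<lambda>z. (norm (fst z))\<^sup>2)"
        "(LINT z|\<pi>. (norm (fst z))\<^sup>2) = (LINT x|mixture \<epsilon> v. (norm x)\<^sup>2)"
        by (rule integrable_coupling_fst[OF \<pi> _ sq_mix], simp, rule integral_coupling_fst[OF \<pi>], simp)
      moreover have "integrable \<pi> (\<lambda>z. norm (snd z) ^ (2 * (j + 2)))"
        "(LINT z|\<pi>. norm (snd z) ^ (2 * (j + 2))) = (LINT x|gaussian. norm (x::'a) ^ (2 * (j + 2)))"
        by (rule integrable_coupling_snd[OF \<pi> _ integrable_gaussian_norm_power], simp,
            rule integral_coupling_snd[OF \<pi>], simp)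
      ultimately show ?thesis by simp
    qed
    also have "\<dots> \<le> (LINT z|\<pi>. norm (fst z - snd z) powr 2)"
    proof (rule integral_mono)
      show "integrable \<pi> (\<lambda>z. h (fst z) - (norm (fst z))\<^sup>2 / (t ^ j)\<^sup>2 - norm (snd z) ^ (2 * (j + 2)) / t\<^sup>2)"
        by (intro Bochner_Integration.integrable_diff integrable_divide integrable_coupling_fst[OF \<pi> _ h_mix]
            integrable_coupling_fst[OF \<pi> _ sq_mix] integrable_coupling_snd[OF \<pi> _ integrable_gaussian_norm_power]) auto
      show "integrable \<pi> (\<lambda>z. norm (fst z - snd z) powr 2)"
        by (rule integrable_coupling_cost[OF _ mixture_in_wasserstein_space gaussian_in_wasserstein_space \<pi>]) simp_all
      fix z :: "'a \<times> 'a"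
      have "h (fst z) - (norm (fst z))\<^sup>2 / (t ^ j)\<^sup>2 - norm (snd z) ^ (2 * (j + 2)) / t\<^sup>2 \<le> (norm (fst z) - norm (snd z))\<^sup>2"
        unfolding h_def using t by (intro square_diff_ge) auto
      also have "\<dots> \<le> (norm (fst z - snd z))\<^sup>2"
        by (subst power2_abs[symmetric]) (intro power_mono norm_triangle_ineq3, simp)
      finally show "h (fst z) - (norm (fst z))\<^sup>2 / (t ^ j)\<^sup>2 - norm (snd z) ^ (2 * (j + 2)) / t\<^sup>2 \<le> norm (fst z - snd z) powr 2"
        by simp
    qed
    finally show ?thesis .
  qed
  have "couplings (mixture \<epsilon> v) gaussian \<noteq> {}" by (rule mixture_coupling) blast
  moreover have "0 \<le> (LINT z|\<pi>. norm (fst z - snd z) powr 2)" for \<pi> :: "('a \<times> 'a) measure" by simp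
  \<comment> \<open>The constant \<open>?c\<close> may be negative, while
    \<open>wasserstein_ge\<close> expects a nonnegative one. Since every cost is nonnegative,
    \<open>max 0 ?c\<close> is also a lower bound.\<close>
  ultimately have "(max 0 ?c) powr (1 / 2) \<le> wasserstein 2 (mixture \<epsilon> v) gaussian"
    using cost by (intro wasserstein_ge) (simp_all only: max.bounded_iff, simp_all)
  then have "(sqrt (max 0 ?c))\<^sup>2 \<le> (wasserstein 2 (mixture \<epsilon> v) gaussian)\<^sup>2"
    by (intro power_mono) (simp_all add: powr_half_sqrt)
  then show ?thesis by simp
qed

text \<open>Writing x = (x - y) + y bounds the p-th moment of the mixture by 2^p times the cost plus
  the Gaussian moment. The shifted components make the former large.\<close>

lemma wasserstein_mixture_ge:
  assumes p: "p > 0"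
    and "0 \<le> \<epsilon> / 2 * norm v powr p / 2 powr p - (LINT x|gaussian. norm (x::'a) powr p)" (is "0 \<le> ?c")
  shows "?c powr (1 / p) \<le> wasserstein p (mixture \<epsilon> v) gaussian"
proof (rule wasserstein_ge[OF assms])
  show "couplings (mixture \<epsilon> v) gaussian \<noteq> {}" by (rule mixture_coupling) blast
  fix \<pi> assume \<pi>: "\<pi> \<in> couplings (mixture \<epsilon> v) gaussian"
  have q: "q > 0 \<Longrightarrow> 0 \<le> q" for q :: real by simp
  have W: "mixture \<epsilon> v \<in> wasserstein_space p" "(gaussian :: 'a measure) \<in> wasserstein_space p"
    using p by (simp_all add: mixture_in_wasserstein_space gaussian_in_wasserstein_space)
  have cost: "integrable \<pi> (\<lambda>z. norm (fst z - snd z) powr p)"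
    by (rule integrable_coupling_cost[OF q[OF p] W \<pi>])
  have mx: "integrable (mixture \<epsilon> v) (\<lambda>x. norm x powr p)"
    and g: "integrable gaussian (\<lambda>x::'a. norm x powr p)"
    using W by (simp_all add: wasserstein_space_def)
  have ix: "integrable \<pi> (\<lambda>z. norm (fst z) powr p)" by (rule integrable_coupling_fst[OF \<pi> _ mx]) simp
  have iy: "integrable \<pi> (\<lambda>z. norm (snd z) powr p)" by (rule integrable_coupling_snd[OF \<pi> _ g]) simp
  have "\<epsilon> / 2 * norm v powr p \<le> (LINT x|mixture \<epsilon> v. norm x powr p)"
    by (rule integral_mixture_norm_powr[OF p])
  also have "\<dots> = (LINT z|\<pi>. norm (fst z) powr p)"
    by (rule integral_coupling_fst[OF \<pi>, symmetric]) simp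
  also have "\<dots> \<le> (LINT z|\<pi>. 2 powr p * (norm (fst z - snd z) powr p + norm (snd z) powr p))"
  proof (rule integral_mono)
    show "norm (fst z) powr p \<le> 2 powr p * (norm (fst z - snd z) powr p + norm (snd z) powr p)"
      for z :: "'a \<times> 'a"
      using norm_add_powr_le[OF q[OF p], of "fst z - snd z" "snd z"] by simp
  qed (use cost ix iy in auto)
  also have "\<dots> = 2 powr p * ((LINT z|\<pi>. norm (fst z - snd z) powr p) + (LINT z|\<pi>. norm (snd z) powr p))"
    using cost iy by simp
  also have "(LINT z|\<pi>. norm (snd z) powr p) = (LINT x|gaussian. norm (x::'a) powr p)"
    by (rule integral_coupling_snd[OF \<pi>]) simp
  finally show "?c \<le> (LINT z|\<pi>. norm (fst z - snd z) powr p)"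
    by (simp add: field_simps)
qed

end

section \<open>Choice of the parameters and passage to the limit\<close>

theorem theorem1p8:
  fixes p :: real
  assumes "p > 1"
  shows "\<exists>(f :: nat \<Rightarrow> real ^ 'n \<Rightarrow> real) (\<mu> :: nat \<Rightarrow> (real ^ 'n) measure).
    (\<forall>k. integrable gaussian (f k) \<and> (\<forall>x. 0 \<le> f k x) \<and>
         \<mu> k = density gaussian (\<lambda>x. ennreal (f k x)) \<and>
         \<mu> k \<in> wasserstein_space 2 \<and> \<mu> k \<in> wasserstein_space p \<and> centered (\<mu> k)) \<and>
    (\<lambda>k. talagrand_deficit (\<mu> k)) \<longlonglongrightarrow> 0 \<and>
    filterlim (\<lambda>k. wasserstein p (\<mu> k) gaussian) at_top sequentially"
proof -
  obtain b :: "real ^ 'n" where "b \<in> Basis" using nonempty_Basis by blast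
  then have b: "norm b = 1" by simp
  \<comment> \<open>The choice gives j (p - 1) > 3, hence j p - (j + 2) \<ge> 1. This is the
    exponent of \<open>t\<close> in \<epsilon> times the p-th power of the norm of
    \<open>v\<close>.\<close>
  obtain j :: nat where j: "3 / (p - 1) < real j" using reals_Archimedean2 by blast
  then have j_pos: "0 < j" using assms by (intro gr0I) (auto simp: field_simps)
  have j': "j * p - (real j + 2) \<ge> 1" using j assms by (simp add: field_simps)
  \<comment> \<open>The offset 2 keeps \<open>t\<close> above 1 from the first index on, so that
    \<epsilon> lies strictly below 1.\<close>
  define t where "t k = real k + 2" for k
  define \<epsilon> where "\<epsilon> k = 1 / t k ^ (j + 2)" for k
  define v where "v k = t k ^ j *\<^sub>R b" for k
  have t: "t k \<ge> 2" for k by (simp add: t_def)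
  have t_lim: "filterlim t at_top sequentially" unfolding t_def by real_asymp
  have v: "norm (v k) = t k ^ j" for k using t[of k] by (simp add: v_def b)
  have eps: "0 < \<epsilon> k" "\<epsilon> k < 1" for k
    using t[of k] one_less_power[of "t k" "j + 2"] by (simp_all add: \<epsilon>_def)
  have mixture: "symmetric_mixture (\<epsilon> k)" for k using eps by unfold_locales
  let ?\<mu> = "\<lambda>k. mixture (\<epsilon> k) (v k)"
  define M1 where "M1 = (LINT x|gaussian. norm (x :: real ^ 'n))"
  define M2 where "M2 = (LINT x|gaussian. (norm (x :: real ^ 'n))\<^sup>2)"
  define M3 where "M3 = (LINT x|gaussian. norm (x :: real ^ 'n) ^ (2 * (j + 2)))"
  define Mp where "Mp = (LINT x|gaussian. norm (x :: real ^ 'n) powr p)"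
  have M: "0 \<le> M1" "0 \<le> M2" "0 \<le> M3" by (simp_all add: M1_def M2_def M3_def)
  \<comment> \<open>The four contributions to \<open>K\<close> are the coefficients of 1 / t in the
    cross term, the second moment term, \<epsilon> and the high moment term. The cross term decays
    because t \<epsilon> t^j = 1 / t.\<close>
  define K where "K = 2 * (M1 + 1) + M2 + 1 + M3"
  have error: "2 * t k * \<epsilon> k * (M1 + norm (v k)) + (M2 / (norm (v k))\<^sup>2 + \<epsilon> k) + M3 / (t k)\<^sup>2 \<le> K / t k" for k
  proof -
    have inv: "1 / t k ^ Suc m \<le> 1 / t k" for m
      using t[of k] self_le_power[of "t k" "Suc m"] by (intro divide_left_mono) auto
    have tj: "1 \<le> t k ^ j" using t[of k] by simp
    have "2 * t k * \<epsilon> k * (M1 + norm (v k)) \<le> 2 * t k * \<epsilon> k * ((M1 + 1) * t k ^ j)"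
      using t[of k] eps[of k] M(1) tj mult_left_mono[OF tj M(1)] unfolding v
      by (intro mult_left_mono) (auto simp: algebra_simps)
    also have "\<dots> = 2 * (M1 + 1) * (1 / t k)"
      using t[of k] by (simp add: \<epsilon>_def power2_eq_square)
    finally have "2 * t k * \<epsilon> k * (M1 + norm (v k)) \<le> 2 * (M1 + 1) * (1 / t k)" .
    \<comment> \<open>Positivity of \<open>j\<close> makes the natural number subtraction exact: the
      successor of \<open>2 * j - 1\<close> is \<open>2 * j\<close>.\<close>
    moreover have "M2 / (norm (v k))\<^sup>2 \<le> M2 * (1 / t k)"
      using mult_left_mono[OF inv[of "2 * j - 1"] M(2)] j_pos
      by (simp add: v power_mult[symmetric] mult.commute)
    moreover have "\<epsilon> k \<le> 1 / t k" unfolding \<epsilon>_def using inv[of "j + 1"] by simp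
    moreover have "M3 / (t k)\<^sup>2 \<le> M3 * (1 / t k)"
      using mult_left_mono[OF inv[of 1] M(3)] by (simp add: power2_eq_square)
    ultimately show ?thesis by (simp add: K_def add_divide_distrib)
  qed
  \<comment> \<open>Twice the entropy gap. Since the trivial coupling bounds the squared distance by
    the leading term of 2 H, \<open>L (\<epsilon> k)\<close> bounds the deficit from below.\<close>
  define L where "L e = 2 * ((1 - e) * ln (1 - e) + e * ln (e / 2))" for e :: real
  have deficit: "\<exists>d. talagrand_deficit (?\<mu> k) = ereal d \<and> L (\<epsilon> k) \<le> d \<and> d \<le> K / t k" for k
  proof -
    interpret symmetric_mixture "\<epsilon> k" "v k" by (rule mixture)
    obtain H where H: "rel_entropy (?\<mu> k) = ereal H" "H \<le> \<epsilon> k * (norm (v k))\<^sup>2 / 2"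
      "\<epsilon> k * (norm (v k))\<^sup>2 / 2 + (1 - \<epsilon> k) * ln (1 - \<epsilon> k) + \<epsilon> k * ln (\<epsilon> k / 2) \<le> H"
      by (rule rel_entropy_mixture)
    have "talagrand_deficit (?\<mu> k) = ereal (2 * H - (wasserstein 2 (?\<mu> k) gaussian)\<^sup>2)"
      unfolding talagrand_deficit_def H(1) by simp
    moreover have "L (\<epsilon> k) \<le> 2 * H - (wasserstein 2 (?\<mu> k) gaussian)\<^sup>2"
      using H(3) wasserstein_2_mixture_le unfolding L_def by argo
    moreover have "0 < t k" using t[of k] by linarith
    from wasserstein_2_mixture_ge[OF this v, folded M1_def M2_def M3_def]
    have "2 * H - (wasserstein 2 (?\<mu> k) gaussian)\<^sup>2 \<le> K / t k"
      using H(2) error[of k] by linarith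
    ultimately show ?thesis by blast
  qed
  then obtain d where d: "\<And>k. talagrand_deficit (?\<mu> k) = ereal (d k)" "\<And>k. L (\<epsilon> k) \<le> d k" "\<And>k. d k \<le> K / t k"
    by metis
  have "filterlim \<epsilon> (at_right 0) sequentially"
    unfolding \<epsilon>_def t_def by real_asymp
  moreover have "(L \<longlongrightarrow> 0) (at_right 0)"
    unfolding L_def by real_asymp
  ultimately have "(\<lambda>k. L (\<epsilon> k)) \<longlonglongrightarrow> 0"
    by (rule filterlim_compose[rotated])
  moreover have "(\<lambda>k. K / t k) \<longlonglongrightarrow> 0"
    by (rule real_tendsto_divide_at_top[OF tendsto_const t_lim])
  ultimately have "d \<longlonglongrightarrow> 0"
    using d(2,3) by (intro tendsto_sandwich[of "\<lambda>k. L (\<epsilon> k)" d sequentially "\<lambda>k. K / t k"]) auto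
  then have "(\<lambda>k. talagrand_deficit (?\<mu> k)) \<longlonglongrightarrow> 0"
    by (simp add: d(1) zero_ereal_def)
  moreover have "filterlim (\<lambda>k. wasserstein p (?\<mu> k) gaussian) at_top sequentially"
  proof -
    define c where "c k = \<epsilon> k / 2 * norm (v k) powr p / 2 powr p - Mp" for k
    have c_ge: "t k / (2 * 2 powr p) - Mp \<le> c k" for k
    proof -
      have t0: "0 < t k" using t[of k] by linarith
      have "\<epsilon> k * norm (v k) powr p = t k powr (j * p) / t k powr (real j + 2)"
      proof -
        have "(t k ^ j) powr p = t k powr (j * p)"
          unfolding powr_realpow[OF t0, symmetric] powr_powr ..
        moreover have "t k ^ (j + 2) = t k powr (real j + 2)"
          unfolding powr_realpow[OF t0, symmetric] by (simp add: add.commute)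
        ultimately show ?thesis unfolding \<epsilon>_def v by simp
      qed
      also have "\<dots> = t k powr (j * p - (real j + 2))" by (simp add: powr_diff)
      also have "\<dots> \<ge> t k powr 1" using t[of k] j' by (intro powr_mono) auto
      finally have "t k \<le> \<epsilon> k * norm (v k) powr p" using t0 by simp
      then show ?thesis by (simp add: c_def field_simps)
    qed
    have "filterlim (\<lambda>k. t k / (2 * 2 powr p) - Mp) at_top sequentially"
      unfolding t_def by real_asymp
    then have c_lim: "filterlim c at_top sequentially"
      by (rule filterlim_at_top_mono) (simp add: c_ge)
    have "filterlim (\<lambda>x::real. x powr (1 / p)) at_top at_top"
      using assms by real_asymp
    from filterlim_compose[OF this c_lim]
    have "filterlim (\<lambda>k. c k powr (1 / p)) at_top sequentially" .
    \<comment> \<open>Only eventually, since the lower bound on the distance requires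
      \<open>c k \<ge> 0\<close>.\<close>
    moreover have "\<forall>\<^sub>F k in sequentially. c k powr (1 / p) \<le> wasserstein p (?\<mu> k) gaussian"
      using c_lim[THEN filterlim_at_top[THEN iffD1], THEN spec, of 0]
    proof eventually_elim
      case (elim k)
      interpret symmetric_mixture "\<epsilon> k" "v k" by (rule mixture)
      show ?case using wasserstein_mixture_ge[of p] assms elim unfolding c_def Mp_def by simp
    qed
    ultimately show ?thesis by (rule filterlim_at_top_mono)
  qed
  moreover have "integrable gaussian (mix (\<epsilon> k) (v k)) \<and> (\<forall>x. 0 \<le> mix (\<epsilon> k) (v k) x) \<and>
      ?\<mu> k \<in> wasserstein_space 2 \<and> ?\<mu> k \<in> wasserstein_space p \<and> centered (?\<mu> k)" for k
  proof -
    interpret symmetric_mixture "\<epsilon> k" "v k" by (rule mixture)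
    show ?thesis
      using assms integrable_mix_density mix_nonneg centered_mixture
      by (simp add: mixture_in_wasserstein_space)
  qed
  ultimately show ?thesis
    by (intro exI[of _ "\<lambda>k. mix (\<epsilon> k) (v k)"] exI[of _ ?\<mu>]) blast
qed

end
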